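(* Let $N,M,T$ be positive integers and $\delta\in(0,1)$, $\alpha>1$, $d>0$ real numbers. Let $\mathcal{H}$ be a family of hash functions $[N]\to[M]$ of size at most $2^d$ and $H$ a uniformly random member of $\mathcal{H}$. Suppose $K\le N$ is an integer with $K\le(\delta^2/(4\alpha\cdot 2^d))^{1/T}\cdot M$. Then there exists a block $K$-source $\mathbf{X}=(X_1,\dots,X_T)$ over $[N]^T$ (independent of $H$) such that $\mathbf{Y}=(H(X_1),\dots,H(X_T))$ is $(1-\delta)$-far in statistical distance from every distribution $\mathbf{Z}$ on $[M]^T$ with $\mathrm{cp}(\mathbf{Z})\le\alpha/M^T$. In particular, $\mathbf{Y}$ is $(1-\delta)$-far from the uniform distribution on $[M]^T$.
   Context: $[n]=\{1,\dots,n\}$. A hash family is a multiset of functions $[N]\to[M]$. $\mathrm{cp}(X)=\sum_x\Pr[X=x]^2$. A sequence $(X_1,\dots,X_T)$ over $[N]^T$ is a block $K$-source if for every $i$ and every $x_{<i}$ in the support of $(X_1,\dots,X_{i-1})$, $\mathrm{cp}(X_i\mid X_{<i}=x_{<i})\le 1/K$. Statistical distance: $\Delta(X,Y)=\max_S|\Pr[X\in S]-\Pr[Y\in S]|$; $\varepsilon$-far means $\Delta\ge\varepsilon$. *)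

theory Defs
  imports "HOL-Probability.Probability" "HOL-Library.NList"
begin

text \<open>The set \<open>[n]\<close> is rendered as \<open>{1..n}\<close>, and \<open>[n]\<^sup>T\<close> as \<open>nlists T {1..n}\<close>, the
  lists of length \<open>T\<close> with entries in \<open>{1..n}\<close>. A probability distribution on a set
  is a pmf whose support is contained in that set.\<close>

text \<open>The extensional function space makes members of the multiset that agree on \<open>[N]\<close> equal.\<close>

definition hash_family :: "nat \<Rightarrow> nat \<Rightarrow> (nat \<Rightarrow> nat) multiset \<Rightarrow> bool" where
  "hash_family N M \<H> \<longleftrightarrow> set_mset \<H> \<subseteq> ({1..N} \<rightarrow>\<^sub>E {1..M})"

definition cp :: "'a pmf \<Rightarrow> real" where
  "cp p = (\<Sum>\<^sub>\<infinity>x\<in>UNIV. (pmf p x)\<^sup>2)"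

text \<open>Sequences are indexed from 0, so \<open>x ! i\<close> is the component \<open>x\<^sub>i\<^sub>+\<^sub>1\<close> and \<open>take i x\<close> consists
  of the components before it. Since \<open>u\<close> ranges over the support of that prefix, the
  conditioning event always has positive probability.\<close>

definition block_source :: "real \<Rightarrow> nat \<Rightarrow> nat \<Rightarrow> nat list pmf \<Rightarrow> bool" where
  "block_source K N T X \<longleftrightarrow>
     set_pmf X \<subseteq> nlists T {1..N} \<and>
     (\<forall>i<T. \<forall>u \<in> set_pmf (map_pmf (take i) X).
        cp (map_pmf (\<lambda>x. x ! i) (cond_pmf X {x. take i x = u})) \<le> 1 / K)"

text \<open>The supremum is attained (at the set of points where \<open>p\<close> has the larger mass), so it is
  the maximum.\<close>

definition stat_dist :: "'a pmf \<Rightarrow> 'a pmf \<Rightarrow> real" where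
  "stat_dist p q = (SUP S. \<bar>measure_pmf.prob p S - measure_pmf.prob q S\<bar>)"

definition far :: "real \<Rightarrow> 'a pmf \<Rightarrow> 'a pmf \<Rightarrow> bool" where
  "far \<epsilon> p q \<longleftrightarrow> stat_dist p q \<ge> \<epsilon>"

text \<open>The distribution of \<open>(H(X\<^sub>1), \<dots>, H(X\<^sub>T))\<close>, where the single function \<open>H\<close> is drawn uniformly
  from the multiset (with multiplicity) and independently of \<open>X\<close>.\<close>

definition hashed :: "(nat \<Rightarrow> nat) multiset \<Rightarrow> nat list pmf \<Rightarrow> nat list pmf" where
  "hashed \<H> X = map_pmf (\<lambda>(h, x). map h x) (pair_pmf (pmf_of_multiset \<H>) X)"

end

theory Submission
  imports Defs
begin

text \<open>Take \<open>X\<close> uniform on \<open>[K]\<^sup>T\<close>. Each member of \<open>\<H>\<close> maps \<open>[K]\<^sup>T\<close> onto at most \<open>K\<^sup>T\<close> points,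
  so \<open>Y\<close> lives on a set \<open>S\<close> of at most \<open>2\<^sup>d K\<^sup>T \<le> \<delta>\<^sup>2 M\<^sup>T / (4 \<alpha>)\<close> points. By Cauchy--Schwarz a
  distribution \<open>Z\<close> gives \<open>S\<close> mass at most the square root of \<open>\<bar>S\<bar> cp(Z)\<close>, which is at most
  \<open>\<delta> / 2\<close>, so \<open>S\<close> separates \<open>Y\<close> from \<open>Z\<close>.\<close>

lemma finite_nlists: "finite A \<Longrightarrow> finite (nlists n A)"
  using finite_lists_length_eq[of A n] unfolding nlists_def by (simp add: conj_commute del: nlistsE_length)

lemma card_nlists: "finite A \<Longrightarrow> card (nlists n A) = card A ^ n"
  using card_lists_length_eq[of A n] unfolding nlists_def by (simp add: conj_commute del: nlistsE_length)

lemma nlists_nonempty: "A \<noteq> {} \<Longrightarrow> nlists n A \<noteq> {}"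
  using nlists_not_empty[of A n] by blast

lemma pair_pmf_of_set:
  assumes "finite A" "A \<noteq> {}" "finite B" "B \<noteq> {}"
  shows "pair_pmf (pmf_of_set A) (pmf_of_set B) = pmf_of_set (A \<times> B)"
proof (rule pmf_eqI)
  fix z
  have "A \<times> B \<noteq> {}" using assms by simp
  then show "pmf (pair_pmf (pmf_of_set A) (pmf_of_set B)) z = pmf (pmf_of_set (A \<times> B)) z"
    using assms by (cases z) (simp add: pmf_pair indicator_times card_cartesian_product)
qed

lemma cond_pmf_of_set:
  assumes "finite A" "A \<inter> B \<noteq> {}"
  shows "cond_pmf (pmf_of_set A) B = pmf_of_set (A \<inter> B)"
proof -
  have "A \<noteq> {}" and "card A > 0" and "card (A \<inter> B) > 0" using assms by (auto simp: card_gt_0_iff)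
  then show ?thesis
    using assms
    by (intro pmf_eqI) (simp add: pmf_cond measure_pmf_of_set indicator_def)
qed

text \<open>Masses are at most 1, so squares are dominated by the masses themselves. Since
  \<open>infsum\<close> is 0 on families that are not summable, this is what allows finite partial
  sums to be compared with \<open>cp\<close>.\<close>

lemma summable_pmf_square: "(\<lambda>x. (pmf p x)\<^sup>2) summable_on A"
proof -
  have "(\<lambda>x. pmf p x) summable_on A"
    using pmf_abs_summable[of p A] abs_summable_equivalent abs_summable_summable by blast
  then show ?thesis
    by (rule summable_on_comparison_test) (auto simp: power2_eq_square pmf_le_1 mult_left_le)
qed

lemma cp_pmf_of_set:
  assumes "finite A" "A \<noteq> {}"
  shows "cp (pmf_of_set A) = 1 / real (card A)"
proof -
  have "cp (pmf_of_set A) = (\<Sum>\<^sub>\<infinity>x\<in>A. (pmf (pmf_of_set A) x)\<^sup>2)"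
    unfolding cp_def by (rule infsum_cong_neutral) (use assms in auto)
  also have "\<dots> = (\<Sum>x\<in>A. (1 / real (card A))\<^sup>2)"
    using assms by simp
  also have "\<dots> = 1 / real (card A)"
    by (simp add: power2_eq_square)
  finally show ?thesis .
qed

text \<open>Cauchy-Schwarz against the constant 1 on \<open>S\<close>; the squared masses over
  \<open>S\<close> are a partial sum of the nonnegative series \<open>cp p\<close>.\<close>

lemma prob_power2_le_card_cp:
  assumes "finite S"
  shows "(measure_pmf.prob p S)\<^sup>2 \<le> real (card S) * cp p"
proof -
  have "(measure_pmf.prob p S)\<^sup>2 = (\<Sum>x\<in>S. 1 * pmf p x)\<^sup>2"
    using assms by (simp add: measure_measure_pmf_finite)
  also have "\<dots> \<le> (\<Sum>x\<in>S. 1\<^sup>2) * (\<Sum>x\<in>S. (pmf p x)\<^sup>2)"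
    by (rule Cauchy_Schwarz_ineq_sum)
  also have "\<dots> \<le> real (card S) * cp p"
    unfolding cp_def using assms
    by (auto intro!: mult_left_mono finite_sum_le_infsum summable_pmf_square)
  finally show ?thesis .
qed

text \<open>Any single event bounds the distance from below. A supremum of reals dominates its
  members only when they are bounded above, here by 1.\<close>

lemma prob_diff_le_stat_dist:
  "measure_pmf.prob p S - measure_pmf.prob q S \<le> stat_dist p q"
proof -
  have "\<bar>measure_pmf.prob p S - measure_pmf.prob q S\<bar> \<le> 1" for S
    using measure_pmf.prob_le_1[of p S] measure_pmf.prob_le_1[of q S]
      measure_nonneg[of "measure_pmf p" S] measure_nonneg[of "measure_pmf q" S] by linarith
  then have "bdd_above (range (\<lambda>S. \<bar>measure_pmf.prob p S - measure_pmf.prob q S\<bar>))"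
    by (intro bdd_aboveI[where M = 1]) blast
  then have "\<bar>measure_pmf.prob p S - measure_pmf.prob q S\<bar> \<le> stat_dist p q"
    unfolding stat_dist_def by (rule cSUP_upper[OF UNIV_I])
  then show ?thesis by linarith
qed

text \<open>The set \<open>S\<close> is the distinguishing event: \<open>p\<close> gives it mass 1,
  while \<open>prob_power2_le_card_cp\<close> limits its mass under \<open>q\<close> to
  \<epsilon>.\<close>

lemma far_of_small_support:
  assumes "finite S" "set_pmf p \<subseteq> S" "real (card S) * cp q \<le> \<epsilon>\<^sup>2" "0 \<le> \<epsilon>"
  shows "far (1 - \<epsilon>) p q"
proof -
  have "measure_pmf.prob p S = 1"
    using assms by (simp add: measure_pmf.prob_eq_1 AE_measure_pmf_iff subset_iff)
  moreover have "measure_pmf.prob q S \<le> \<epsilon>"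
    using prob_power2_le_card_cp[OF assms(1), of q] assms(3,4) by (meson order_trans power2_le_imp_le)
  ultimately show ?thesis
    using prob_diff_le_stat_dist[of p S q] by (simp add: far_def)
qed

text \<open>Splitting off the entry after the prefix shows the conditioning event to be a copy of a
  product, with that entry as a free factor.\<close>

lemma nlists_fixed_prefix:
  assumes "i < T" "u \<in> nlists i A"
  shows "nlists T A \<inter> {x. take i x = u} = (\<lambda>(k, w). u @ k # w) ` (A \<times> nlists (T - Suc i) A)"
proof (intro set_eqI iffI)
  fix x assume "x \<in> nlists T A \<inter> {x. take i x = u}"
  then have x: "length x = T" "set x \<subseteq> A" "take i x = u" by (auto simp: nlists_def simp del: nlistsE_length nlistsE_set)
  then have "x = (\<lambda>(k, w). u @ k # w) (x ! i, drop (Suc i) x)"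
    using assms(1) id_take_nth_drop[of i x] by simp
  moreover have "(x ! i, drop (Suc i) x) \<in> A \<times> nlists (T - Suc i) A"
    using x assms(1) set_drop_subset[of "Suc i" x] by (auto intro!: nlistsI)
  ultimately show "x \<in> (\<lambda>(k, w). u @ k # w) ` (A \<times> nlists (T - Suc i) A)"
    by (rule image_eqI)
next
  fix x assume "x \<in> (\<lambda>(k, w). u @ k # w) ` (A \<times> nlists (T - Suc i) A)"
  with assms show "x \<in> nlists T A \<inter> {x. take i x = u}"
    by (auto simp: nlists_def simp del: nlistsE_length nlistsE_set)
qed

text \<open>Conditioning a uniform law leaves it uniform on the event. By
  \<open>nlists_fixed_prefix\<close> the event is an injective image of a product, so the next entry
  and the tail are independent and uniform.\<close>

lemma nth_cond_pmf_of_set_nlists: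
  assumes "finite A" "A \<noteq> {}" "i < T" "u \<in> nlists i A"
  shows "map_pmf (\<lambda>x. x ! i) (cond_pmf (pmf_of_set (nlists T A)) {x. take i x = u}) = pmf_of_set A"
proof -
  let ?f = "\<lambda>(k, w). u @ k # w" and ?B = "nlists (T - Suc i) A"
  have B: "finite ?B" "?B \<noteq> {}" using assms by (simp_all add: finite_nlists nlists_nonempty)
  have "cond_pmf (pmf_of_set (nlists T A)) {x. take i x = u} = pmf_of_set (?f ` (A \<times> ?B))"
    using assms B by (subst cond_pmf_of_set) (auto simp: finite_nlists nlists_fixed_prefix)
  also have "\<dots> = map_pmf ?f (pair_pmf (pmf_of_set A) (pmf_of_set ?B))"
    using assms B by (subst map_pmf_of_set_inj[symmetric]) (auto simp: inj_on_def pair_pmf_of_set)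
  finally have "map_pmf (\<lambda>x. x ! i) (cond_pmf (pmf_of_set (nlists T A)) {x. take i x = u}) =
      map_pmf ((\<lambda>x. x ! i) \<circ> ?f) (pair_pmf (pmf_of_set A) (pmf_of_set ?B))"
    by (simp add: pmf.map_comp)
  \<comment> \<open>With indices from 0 and \<open>length u = i\<close>, the entry at
    \<open>i\<close> of \<open>u @ k # w\<close> is \<open>k\<close>.\<close>
  also have "(\<lambda>x. x ! i) \<circ> ?f = fst"
    using assms(4) by (auto simp: fun_eq_iff nth_append)
  finally show ?thesis by (simp add: map_fst_pair_pmf)
qed

text \<open>Every conditional law of an entry is uniform on \<open>A\<close>, so the required bound
  on its collision probability holds with equality.\<close>

lemma block_source_uniform:
  assumes "A \<subseteq> {1..N}" "A \<noteq> {}"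
  shows "block_source (real (card A)) N T (pmf_of_set (nlists T A))"
proof -
  have A: "finite A" using assms finite_subset by blast
  have supp: "set_pmf (pmf_of_set (nlists T A)) = nlists T A"
    using A assms by (simp add: finite_nlists nlists_nonempty)
  show ?thesis
    unfolding block_source_def
  proof (intro conjI allI impI ballI)
    show "set_pmf (pmf_of_set (nlists T A)) \<subseteq> nlists T {1..N}"
      using nlists_mono[OF assms(1)] supp by simp
    fix i u
    assume "i < T" and "u \<in> set_pmf (map_pmf (take i) (pmf_of_set (nlists T A)))"
    then obtain x where "u = take i x" "length x = T" "set x \<subseteq> A"
      by (auto simp: supp)
    with \<open>i < T\<close> have "u \<in> nlists i A"
      using set_take_subset[of i x] by (auto intro!: nlistsI)
    with A assms \<open>i < T\<close>
    show "cp (map_pmf (\<lambda>x. x ! i) (cond_pmf (pmf_of_set (nlists T A)) {x. take i x = u}))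
        \<le> 1 / real (card A)"
      by (simp add: nth_cond_pmf_of_set_nlists cp_pmf_of_set)
  qed
qed

lemma set_pmf_hashed:
  assumes "\<H> \<noteq> {#}" "finite A" "A \<noteq> {}"
  shows "set_pmf (hashed \<H> (pmf_of_set (nlists T A))) \<subseteq> (\<Union>h\<in>set_mset \<H>. map h ` nlists T A)"
  using assms by (auto simp: hashed_def finite_nlists nlists_nonempty)

lemma card_hashed_support:
  assumes "finite A"
  shows "card (\<Union>h\<in>set_mset \<H>. map h ` nlists T A) \<le> size \<H> * card A ^ T"
proof -
  have "card (\<Union>h\<in>set_mset \<H>. map h ` nlists T A) \<le> (\<Sum>h\<in>set_mset \<H>. card (map h ` nlists T A))"
    by (rule card_UN_le) simp
  also have "\<dots> \<le> (\<Sum>h\<in>set_mset \<H>. card A ^ T)"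
    using assms by (intro sum_mono) (metis card_image_le card_nlists finite_nlists)
  also have "\<dots> = card (set_mset \<H>) * card A ^ T" by simp
  \<comment> \<open>Each distinct member has multiplicity at least 1.\<close>
  also have "card (set_mset \<H>) \<le> size \<H>"
    unfolding size_multiset_overloaded_eq card_eq_sum
    by (rule sum_mono) (simp add: Suc_le_eq)
  finally show ?thesis by simp
qed

text \<open>The conditions \<open>\<H> \<noteq> {#}\<close> and \<open>K \<ge> 1\<close> ensure that
  a uniform member of the family and the uniform law on \<open>nlists T {1..K}\<close>
  exist.\<close>

theorem theorem4p10:
  fixes N M T K :: nat and \<delta> \<alpha> d :: real and \<H> :: "(nat \<Rightarrow> nat) multiset"
  assumes "N \<ge> 1" and "M \<ge> 1" and "T \<ge> 1"
    and "0 < \<delta>" and "\<delta> < 1" and "\<alpha> > 1" and "d > 0"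
    and "hash_family N M \<H>" and "\<H> \<noteq> {#}" and "real (size \<H>) \<le> 2 powr d"
    and "K \<ge> 1" and "K \<le> N"
    and "real K \<le> (\<delta>\<^sup>2 / (4 * \<alpha> * 2 powr d)) powr (1 / real T) * real M"
  shows "\<exists>X. block_source (real K) N T X \<and>
           (\<forall>Z. set_pmf Z \<subseteq> nlists T {1..M} \<and> cp Z \<le> \<alpha> / real M ^ T
                  \<longrightarrow> far (1 - \<delta>) (hashed \<H> X) Z) \<and>
           far (1 - \<delta>) (hashed \<H> X) (pmf_of_set (nlists T {1..M}))"
proof -
  define X where "X = pmf_of_set (nlists T {1..K})"
  define S where "S = (\<Union>h\<in>set_mset \<H>. map h ` nlists T {1..K})"
  let ?c = "\<delta>\<^sup>2 / (4 * \<alpha> * 2 powr d)"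
  have c: "?c > 0" using assms by simp
  \<comment> \<open>Undoes the \<open>T\<close>-th root in the bound on \<open>K\<close>; the
    exponent \<open>1 / real T\<close> is a genuine inverse because \<open>T\<close> is
    positive.\<close>
  have root: "(y powr (1 / real T)) ^ T = y" if "y > 0" for y
    using that \<open>T \<ge> 1\<close> by (simp add: powr_power)
  have "real K ^ T \<le> (?c powr (1 / real T) * real M) ^ T"
    using assms by (intro power_mono) auto
  also have "\<dots> = ?c * real M ^ T"
    by (simp only: power_mult_distrib root[OF c])
  finally have KT: "real K ^ T \<le> ?c * real M ^ T" .
  have "real (card S) \<le> real (size \<H>) * real K ^ T"
    using card_hashed_support[of "{1..K}" T \<H>] unfolding S_def
    by (simp flip: of_nat_power of_nat_mult)
  also have "\<dots> \<le> 2 powr d * (?c * real M ^ T)"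
    using assms KT by (intro mult_mono) auto
  \<comment> \<open>The number of hash functions cancels against the factor \<open>2 powr d\<close>
    in the denominator of \<open>?c\<close>.\<close>
  also have "\<dots> = \<delta>\<^sup>2 / (4 * \<alpha>) * real M ^ T" by simp
  finally have S: "real (card S) \<le> \<delta>\<^sup>2 / (4 * \<alpha>) * real M ^ T" .
  have fin: "finite S" by (simp add: S_def finite_nlists)
  have supp: "set_pmf (hashed \<H> X) \<subseteq> S"
    using set_pmf_hashed[of \<H> "{1..K}" T] assms by (simp add: X_def S_def)
  have far: "far (1 - \<delta>) (hashed \<H> X) Z" if "cp Z \<le> \<alpha> / real M ^ T" for Z
  proof (rule far_of_small_support[OF fin supp])
    have "real (card S) * cp Z \<le> real (card S) * (\<alpha> / real M ^ T)"
      using that by (rule mult_left_mono) simp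
    also have "\<dots> \<le> \<delta>\<^sup>2 / (4 * \<alpha>) * real M ^ T * (\<alpha> / real M ^ T)"
      using S assms by (intro mult_right_mono) auto
    also have "\<dots> = \<delta>\<^sup>2 / 4" using assms by simp
    \<comment> \<open>The factor 4 leaves room to spare: the mass of \<open>S\<close> under
      \<open>Z\<close> is in fact at most half of \<delta>.\<close>
    also have "\<dots> \<le> \<delta>\<^sup>2" by simp
    finally show "real (card S) * cp Z \<le> \<delta>\<^sup>2" .
  qed (use assms in simp)
  \<comment> \<open>The uniform law is one of the admissible \<open>Z\<close>, since \<alpha>
    exceeds 1.\<close>
  have "cp (pmf_of_set (nlists T {1..M})) = 1 / real M ^ T"
    using assms by (subst cp_pmf_of_set) (auto simp: finite_nlists nlists_nonempty card_nlists)
  also have "\<dots> \<le> \<alpha> / real M ^ T" using assms by (intro divide_right_mono) auto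
  finally have "far (1 - \<delta>) (hashed \<H> X) (pmf_of_set (nlists T {1..M}))" by (rule far)
  moreover have "block_source (real K) N T X"
    using block_source_uniform[of "{1..K}" N T] assms by (simp add: X_def)
  ultimately show ?thesis using far by blast
qed

end
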